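(* There is an algorithm which, given a parameter $\varepsilon\in(0,1)$ and access to the \textsc{Samp} and \textsc{Pcond} oracles of an arbitrary (unknown) distribution $\mathcal{D}$ over $[N]$, makes $\tilde{O}(\varepsilon^{-2})$ queries and outputs an estimate of $d_{\mathrm{TV}}(\mathcal{D},\mathcal{U})$ that is within additive error $\varepsilon$ with probability at least $2/3$, where $\mathcal{U}$ is the uniform distribution over $[N]$.
   Context: For a distribution $\mathcal{D}$ over $[N]=\{1,\dots,N\}$ write $D(i)=\Pr_{x\sim\mathcal{D}}(x=i)$ and $D(S)=\sum_{i\in S}D(i)$. The \textsc{Samp} oracle returns an independent sample $x\sim\mathcal{D}$. The \textsc{Pcond} oracle takes distinct $x,y\in[N]$ and returns $x$ with probability $\frac{D(x)}{D(x)+D(y)}$ and $y$ otherwise, independently of all previous calls. Total variation distance is $d_{\mathrm{TV}}(\mathcal{D}_1,\mathcal{D}_2)=\frac12\sum_{i=1}^N|D_1(i)-D_2(i)|$. $\tilde O(\cdot)$ hides factors polylogarithmic in $1/\varepsilon$; in particular the query bound does not depend on $N$. *)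

theory Defs
  imports "HOL-Probability.Probability" "HOL-Library.Landau_Symbols"
begin

text \<open>
  Adaptive randomised query algorithms as decision trees.  \<open>Rand p k\<close> draws internal randomness
  and is not a query; the other two nodes continue depending on the answer of the oracle.
\<close>

datatype 'a query_alg =
    Output 'a
  | Rand "nat pmf" "nat \<Rightarrow> 'a query_alg"
  | Samp "nat \<Rightarrow> 'a query_alg"
  | Pcond nat nat "nat \<Rightarrow> 'a query_alg"

text \<open>
  \<open>P x y\<close> is the distribution of the answer to a pairwise conditional query on \<open>x\<close>, \<open>y\<close>.
  If \<open>x\<close> and \<open>y\<close> both have mass zero, the quotient is undefined, and the answer may follow an
  arbitrary distribution on \<open>{x, y}\<close>.
\<close>

definition pcond_oracle :: "nat \<Rightarrow> nat pmf \<Rightarrow> (nat \<Rightarrow> nat \<Rightarrow> nat pmf) \<Rightarrow> bool" where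
  "pcond_oracle N D P \<longleftrightarrow>
     (\<forall>x\<in>{1..N}. \<forall>y\<in>{1..N}. x \<noteq> y \<longrightarrow>
        set_pmf (P x y) \<subseteq> {x, y} \<and>
        (pmf D x + pmf D y > 0 \<longrightarrow> pmf (P x y) x = pmf D x / (pmf D x + pmf D y)))"

text \<open>Every query is answered by a fresh draw, hence independently of all earlier answers.\<close>

primrec run :: "nat pmf \<Rightarrow> (nat \<Rightarrow> nat \<Rightarrow> nat pmf) \<Rightarrow> 'a query_alg \<Rightarrow> 'a pmf" where
  "run D P (Output v) = return_pmf v"
| "run D P (Rand p k) = bind_pmf p (\<lambda>i. run D P (k i))"
| "run D P (Samp k) = bind_pmf D (\<lambda>i. run D P (k i))"
| "run D P (Pcond x y k) = bind_pmf (P x y) (\<lambda>i. run D P (k i))"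

text \<open>
  \<open>within_queries N q A\<close>: for all possible oracle answers and all internal coin outcomes, \<open>A\<close>
  makes at most \<open>q\<close> queries, and its pairwise queries are on distinct elements of \<open>{1..N}\<close>.
\<close>

inductive within_queries :: "nat \<Rightarrow> nat \<Rightarrow> 'a query_alg \<Rightarrow> bool" for N where
  Output: "within_queries N q (Output v)"
| Rand: "(\<And>i. i \<in> set_pmf p \<Longrightarrow> within_queries N q (k i)) \<Longrightarrow> within_queries N q (Rand p k)"
| Samp: "(\<And>i. i \<in> {1..N} \<Longrightarrow> within_queries N q (k i)) \<Longrightarrow> within_queries N (Suc q) (Samp k)"
| Pcond: "x \<in> {1..N} \<Longrightarrow> y \<in> {1..N} \<Longrightarrow> x \<noteq> y \<Longrightarrow>
    (\<And>i. i \<in> {x, y} \<Longrightarrow> within_queries N q (k i)) \<Longrightarrow> within_queries N (Suc q) (Pcond x y k)"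

definition tv_dist :: "nat \<Rightarrow> nat pmf \<Rightarrow> nat pmf \<Rightarrow> real" where
  "tv_dist N D1 D2 = 1 / 2 * (\<Sum>i=1..N. \<bar>pmf D1 i - pmf D2 i\<bar>)"

text \<open>
  Bounds up to factors polylogarithmic in \<open>1 / \<epsilon>\<close>.  The filter makes the constant uniform over
  all of \<open>0 < \<epsilon> < 1\<close>; the summand 1 is needed because \<open>ln (1 / \<epsilon>)\<close> vanishes as \<open>\<epsilon>\<close> tends to 1.
\<close>

definition soft_O :: "(real \<Rightarrow> real) \<Rightarrow> (real \<Rightarrow> real) set" where
  "soft_O g = (\<Union>k::nat. O[principal {0<..<1}](\<lambda>\<epsilon>. g \<epsilon> * (1 + ln (1 / \<epsilon>)) ^ k))"

end

theory Submission imports Defs "HOL-Real_Asymp.Real_Asymp" begin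

text \<open>
  One has \<open>d\<^sub>T\<^sub>V(D, U) = 1 - E[min 1 (1 / (N D(x)))]\<close> for \<open>x\<close> drawn from \<open>D\<close>.  Let \<open>A\<^sub>x\<close> be the
  probability that \<open>x\<close> loses a pairwise query against a uniform element, and \<open>B\<^sub>x\<close> the
  probability that it wins against a sample of \<open>D\<close>.  Then \<open>A\<^sub>x / B\<^sub>x = 1 / (N D(x))\<close>, so the ratio
  of the two empirical frequencies after \<open>n\<close> rounds estimates the integrand, and its mean
  square error is \<open>O(1 / (n B\<^sub>x))\<close>.  Moreover \<open>B\<^sub>x\<close> is at least half the \<open>D\<close>-probability of
  drawing an element no heavier than \<open>x\<close>, and this rank stochastically dominates a uniform
  variable; averaged over \<open>x\<close>, the error is therefore \<open>O(log n / n)\<close>, with no dependence on \<open>N\<close>.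

  Using one value of \<open>n\<close> would cost \<open>\<epsilon>\<^sup>-\<^sup>4\<close> queries.  Instead the estimate for \<open>n = 2\<^sup>L\<close> is
  telescoped over \<open>n = 2\<^sup>k\<close>, \<open>k \<le> L\<close>: the \<open>k\<close>-th difference has variance \<open>O(k / 2\<^sup>k)\<close>, so averaging
  \<open>2\<^sup>L\<^sup>-\<^sup>k\<close> copies makes every level cost \<open>O(2\<^sup>L)\<close> and contribute variance \<open>O(L / 2\<^sup>L)\<close>.  Chebyshev's
  inequality then suffices with \<open>2\<^sup>L\<close> of order \<open>L\<^sup>2 / \<epsilon>\<^sup>2\<close>.
\<close>

section \<open>Expectation, mean and variance for finitely supported distributions\<close>

abbreviation E :: "'a pmf \<Rightarrow> ('a \<Rightarrow> real) \<Rightarrow> real" where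
  "E \<equiv> measure_pmf.expectation"

lemma expectation_bind_finite:
  fixes h :: "'b \<Rightarrow> real"
  assumes "finite (set_pmf p)" "\<And>x. x \<in> set_pmf p \<Longrightarrow> finite (set_pmf (f x))"
  shows "E (bind_pmf p f) h = E p (\<lambda>x. E (f x) h)"
  using assms by (subst pmf_expectation_bind[of "set_pmf p"])
    (auto simp: integral_measure_pmf_real[of "set_pmf p"] mult.commute)

lemma expectation_mono_finite:
  assumes "finite (set_pmf p)" "\<And>x. x \<in> set_pmf p \<Longrightarrow> f x \<le> (g x :: real)"
  shows "E p f \<le> E p g"
  by (intro integral_mono_AE integrable_measure_pmf_finite assms(1))
    (simp add: AE_measure_pmf_iff assms(2))

lemma expectation_cong_pmf:
  assumes "\<And>x. x \<in> set_pmf p \<Longrightarrow> f x = (g x :: real)"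
  shows "E p f = E p g"
  by (intro integral_cong_AE) (simp_all add: AE_measure_pmf_iff assms)

lemma expectation_of_bool: "E p (\<lambda>x. of_bool (Q x)) = measure_pmf.prob p {x. Q x}"
proof -
  have "(\<lambda>x. of_bool (Q x) :: real) = indicator {x. Q x}" by (auto simp: indicator_def)
  then show ?thesis by simp
qed

lemma expectation_square_le:
  assumes "finite (set_pmf p)"
  shows "(E p f)\<^sup>2 \<le> E p (\<lambda>x. (f x)\<^sup>2)"
proof -
  have "0 \<le> E p (\<lambda>x. (f x - E p f)\<^sup>2)" by simp
  also have "\<dots> = E p (\<lambda>x. (f x)\<^sup>2) - (E p f)\<^sup>2"
    by (rule measure_pmf.variance_eq) (auto intro: integrable_measure_pmf_finite assms)
  finally show ?thesis by simp
qed

text \<open>The mean is exact because the levels have to telescope, whereas a bound suffices for the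
  variance. Finite support settles integrability.\<close>

definition moments :: "real pmf \<Rightarrow> real \<Rightarrow> real \<Rightarrow> bool" where
  "moments p m v \<longleftrightarrow> finite (set_pmf p) \<and> E p (\<lambda>x. x) = m \<and> E p (\<lambda>x. (x - m)\<^sup>2) \<le> v"

lemma momentsD:
  assumes "moments p m v"
  shows "finite (set_pmf p)" "E p (\<lambda>x. x) = m" "E p (\<lambda>x. (x - m)\<^sup>2) \<le> v"
  using assms by (auto simp: moments_def)

lemma moments_of_square:
  assumes "finite (set_pmf p)" "E p (\<lambda>x. x) = m" "E p (\<lambda>x. x\<^sup>2) \<le> v"
  shows "moments p m v"
proof -
  have "E p (\<lambda>x. (x - m)\<^sup>2) = E p (\<lambda>x. x\<^sup>2) - m\<^sup>2"
    using measure_pmf.variance_eq[of p "\<lambda>x. x"] assms(1,2)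
    by (auto intro: integrable_measure_pmf_finite)
  then have "E p (\<lambda>x. (x - m)\<^sup>2) \<le> v"
    using assms(3) by (smt (verit) zero_le_power2)
  then show ?thesis using assms(1,2) by (simp add: moments_def)
qed

text \<open>\<open>a\<close> and \<open>b\<close> are drawn independently, so the cross term of the
  square has mean zero and the variances add.\<close>

lemma moments_add:
  assumes p: "moments p m v" and q: "moments q m' v'"
  shows "moments (bind_pmf p (\<lambda>a. bind_pmf q (\<lambda>b. return_pmf (a + c * b))))
    (m + c * m') (v + c\<^sup>2 * v')"
proof -
  note fp = momentsD(1)[OF p] and fq = momentsD(1)[OF q]
  note int = integrable_measure_pmf_finite[OF fp] integrable_measure_pmf_finite[OF fq]
  have ev: "E (bind_pmf p (\<lambda>a. bind_pmf q (\<lambda>b. return_pmf (a + c * b)))) h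
      = E p (\<lambda>a. E q (\<lambda>b. h (a + c * b)))" for h
    using fp fq by (simp add: expectation_bind_finite)
  have mean: "E p (\<lambda>a. E q (\<lambda>b. a + c * b)) = m + c * m'"
    using momentsD(2)[OF p] momentsD(2)[OF q] by (simp add: int)
  have z: "E q (\<lambda>b. b - m') = 0" "E p (\<lambda>a. a - m) = 0"
    using momentsD(2)[OF p] momentsD(2)[OF q] by (simp_all add: int)
  have "E q (\<lambda>b. (a + c * b - (m + c * m'))\<^sup>2)
      = (a - m)\<^sup>2 + c\<^sup>2 * E q (\<lambda>b. (b - m')\<^sup>2)" for a
  proof -
    have "E q (\<lambda>b. (a + c * b - (m + c * m'))\<^sup>2)
        = E q (\<lambda>b. (a - m)\<^sup>2 + (2 * c * (a - m)) * (b - m') + c\<^sup>2 * (b - m')\<^sup>2)"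
      by (rule arg_cong[where f = "E q"]) (auto simp: power2_eq_square algebra_simps)
    also have "\<dots> = (a - m)\<^sup>2 + (2 * c * (a - m)) * E q (\<lambda>b. b - m') + c\<^sup>2 * E q (\<lambda>b. (b - m')\<^sup>2)"
      by (simp add: int del: Bochner_Integration.integral_diff)
    finally show ?thesis using z by simp
  qed
  then have "E p (\<lambda>a. E q (\<lambda>b. (a + c * b - (m + c * m'))\<^sup>2))
      = E p (\<lambda>a. (a - m)\<^sup>2) + c\<^sup>2 * E q (\<lambda>b. (b - m')\<^sup>2)"
    by (simp add: int)
  also have "\<dots> \<le> v + c\<^sup>2 * v'"
    using momentsD(3)[OF p] momentsD(3)[OF q] by (intro add_mono mult_left_mono) auto
  finally show ?thesis using mean fp fq by (simp add: moments_def ev)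
qed

section \<open>Sequencing and repetition of query algorithms\<close>

primrec bind_alg :: "'a query_alg \<Rightarrow> ('a \<Rightarrow> 'b query_alg) \<Rightarrow> 'b query_alg" where
  "bind_alg (Output v) f = f v"
| "bind_alg (Rand p k) f = Rand p (\<lambda>i. bind_alg (k i) f)"
| "bind_alg (Samp k) f = Samp (\<lambda>i. bind_alg (k i) f)"
| "bind_alg (Pcond x y k) f = Pcond x y (\<lambda>i. bind_alg (k i) f)"

lemma run_bind_alg: "run D P (bind_alg A f) = bind_pmf (run D P A) (\<lambda>a. run D P (f a))"
  by (induction A) (simp_all add: bind_return_pmf bind_assoc_pmf)

lemma within_queries_mono:
  "within_queries N q A \<Longrightarrow> q \<le> q' \<Longrightarrow> within_queries N q' A"
proof (induction arbitrary: q' rule: within_queries.induct)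
  case (Samp q k)
  then obtain r where "q' = Suc r" "q \<le> r" by (cases q') auto
  with Samp show ?case by (auto intro: within_queries.intros)
next
  case (Pcond x y q k)
  then obtain r where "q' = Suc r" "q \<le> r" by (cases q') auto
  with Pcond show ?case by (auto intro: within_queries.intros)
qed (auto intro: within_queries.intros)

lemma within_queries_bind:
  "within_queries N q A \<Longrightarrow> (\<And>a. within_queries N q' (f a)) \<Longrightarrow>
    within_queries N (q + q') (bind_alg A f)"
proof (induction rule: within_queries.induct)
  case (Output q v)
  then show ?case using within_queries_mono[of N q' "f v"] by simp
qed (auto intro: within_queries.intros)

text \<open>Sums instead of averages: in \<open>ratio_alg\<close> the number of rounds cancels in
  the quotient, and \<open>multilevel_alg\<close> divides explicitly.\<close>

primrec sum_runs :: "nat \<Rightarrow> real query_alg \<Rightarrow> real query_alg" where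
  "sum_runs 0 A = Output 0"
| "sum_runs (Suc n) A = bind_alg (sum_runs n A) (\<lambda>s. bind_alg A (\<lambda>a. Output (s + a)))"

lemma moments_sum_runs:
  assumes "moments (run D P A) m v"
  shows "moments (run D P (sum_runs n A)) (real n * m) (real n * v)"
proof (induction n)
  case (Suc n)
  then show ?case using moments_add[OF Suc assms, of 1]
    by (simp add: run_bind_alg algebra_simps)
qed (simp add: moments_def)

lemma set_pmf_sum_runs_nonneg:
  assumes "set_pmf (run D P A) \<subseteq> {0..}"
  shows "set_pmf (run D P (sum_runs n A)) \<subseteq> {0..}"
  using assms by (induction n) (fastforce simp: run_bind_alg)+

lemma within_queries_sum_runs:
  assumes "within_queries N q A"
  shows "within_queries N (n * q) (sum_runs n A)"
proof (induction n)
  case (Suc n)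
  have "within_queries N (n * q + (q + 0)) (sum_runs (Suc n) A)"
    unfolding sum_runs.simps
    by (intro within_queries_bind Suc assms within_queries.Output)
  then show ?case by (simp add: add.commute)
qed (simp add: within_queries.Output)

section \<open>The estimator\<close>

text \<open>
  Pairwise queries need distinct elements; the value \<open>1 / 2\<close> on the diagonal keeps the formula
  \<open>D(x) / (D(x) + D(y))\<close> for the mean valid there.
\<close>

definition duel :: "nat \<Rightarrow> nat \<Rightarrow> real query_alg" where
  "duel x y = (if x = y then Output (1 / 2) else Pcond x y (\<lambda>z. Output (of_bool (z = x))))"

text \<open>The opponent \<open>y\<close> comes first, so that the outcome 1 records a defeat of
  \<open>x\<close>.\<close>

definition uniform_coin :: "nat \<Rightarrow> nat \<Rightarrow> real query_alg" where
  "uniform_coin N x = Rand (pmf_of_set {1..N}) (\<lambda>y. duel y x)"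

definition sample_coin :: "nat \<Rightarrow> real query_alg" where
  "sample_coin x = Samp (\<lambda>y. duel x y)"

text \<open>
  If \<open>b = 0\<close> the output is \<open>0\<close>, which the error bound below tolerates.
\<close>

definition ratio_alg :: "nat \<Rightarrow> nat \<Rightarrow> nat \<Rightarrow> real query_alg" where
  "ratio_alg N n x = bind_alg (sum_runs n (uniform_coin N x)) (\<lambda>a.
     bind_alg (sum_runs n (sample_coin x)) (\<lambda>b. Output (min 1 (a / b))))"

text \<open>
  For \<open>k = 0\<close> the coarser estimate uses \<open>1 div 2 = 0\<close> rounds and is identically \<open>0\<close>, so that the
  differences telescope.
\<close>

definition level_alg :: "nat \<Rightarrow> nat \<Rightarrow> real query_alg" where
  "level_alg N k = Samp (\<lambda>x. bind_alg (ratio_alg N (2 ^ k) x) (\<lambda>h.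
     bind_alg (ratio_alg N (2 ^ k div 2) x) (\<lambda>h'. Output (h - h'))))"

text \<open>The last argument counts the levels already processed, hence levels 0 to
  \<open>L\<close> need the value \<open>Suc L\<close>.\<close>

primrec multilevel_alg :: "nat \<Rightarrow> nat \<Rightarrow> nat \<Rightarrow> real query_alg" where
  "multilevel_alg N L 0 = Output 0"
| "multilevel_alg N L (Suc k) = bind_alg (multilevel_alg N L k) (\<lambda>s.
     bind_alg (sum_runs (2 ^ (L - k)) (level_alg N k)) (\<lambda>t. Output (s + 1 / 2 ^ (L - k) * t)))"

definition tv_alg :: "nat \<Rightarrow> nat \<Rightarrow> real query_alg" where
  "tv_alg N L = bind_alg (multilevel_alg N L (Suc L)) (\<lambda>s. Output (1 - s))"

section \<open>Query complexity\<close>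

lemma within_queries_duel:
  assumes "x \<in> {1..N}" "y \<in> {1..N}"
  shows "within_queries N (Suc 0) (duel x y)"
  unfolding duel_def using assms by (auto intro!: within_queries.intros)

lemma within_queries_uniform_coin:
  assumes "N \<ge> 1" "x \<in> {1..N}"
  shows "within_queries N (Suc 0) (uniform_coin N x)"
  unfolding uniform_coin_def using assms
  by (auto intro!: within_queries.Rand within_queries_duel)

lemma within_queries_sample_coin:
  assumes "x \<in> {1..N}"
  shows "within_queries N (Suc (Suc 0)) (sample_coin x)"
  unfolding sample_coin_def using assms by (intro within_queries.Samp within_queries_duel)

lemma within_queries_ratio_alg:
  assumes "N \<ge> 1" "x \<in> {1..N}"
  shows "within_queries N (3 * n) (ratio_alg N n x)"
proof -
  have "within_queries N (n * Suc 0 + (n * Suc (Suc 0) + 0)) (ratio_alg N n x)"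
    unfolding ratio_alg_def
    by (intro within_queries_bind within_queries_sum_runs within_queries_uniform_coin
        within_queries_sample_coin within_queries.Output assms)
  then show ?thesis by (rule within_queries_mono) simp
qed

text \<open>A round costs one query against a uniform opponent and two against a sampled one. There
  are at most \<open>2 * 2 ^ k\<close> rounds, and drawing \<open>x\<close> adds one query, which
  \<open>2 ^ k\<close> covers.\<close>

lemma within_queries_level_alg:
  assumes "N \<ge> 1"
  shows "within_queries N (7 * 2 ^ k) (level_alg N k)"
proof -
  have "within_queries N (Suc (3 * 2 ^ k + (3 * (2 ^ k div 2) + 0))) (level_alg N k)"
    unfolding level_alg_def
    by (intro within_queries.Samp within_queries_bind within_queries_ratio_alg
        within_queries.Output assms) auto
  moreover have "Suc (3 * 2 ^ k + (3 * (2 ^ k div 2) + 0)) \<le> (7 * 2 ^ k :: nat)"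
    using one_le_power[of "2::nat" k] by linarith
  ultimately show ?thesis by (rule within_queries_mono)
qed

lemma within_queries_multilevel_alg:
  assumes "N \<ge> 1"
  shows "k \<le> Suc L \<Longrightarrow> within_queries N (7 * 2 ^ L * k) (multilevel_alg N L k)"
proof (induction k)
  case (Suc k)
  have "within_queries N (7 * 2 ^ L * k + (2 ^ (L - k) * (7 * 2 ^ k) + 0)) (multilevel_alg N L (Suc k))"
    unfolding multilevel_alg.simps using Suc
    by (intro within_queries_bind within_queries_sum_runs within_queries_level_alg
        within_queries.Output assms) auto
  moreover have "(2::nat) ^ (L - k) * 2 ^ k = 2 ^ L"
    using Suc.prems by (simp flip: power_add)
  ultimately show ?case by (simp add: algebra_simps)
qed (simp add: within_queries.Output)

lemma within_queries_tv_alg: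
  assumes "N \<ge> 1"
  shows "within_queries N (7 * 2 ^ L * Suc L) (tv_alg N L)"
proof -
  have "within_queries N (7 * 2 ^ L * Suc L + 0) (tv_alg N L)"
    unfolding tv_alg_def
    by (intro within_queries_bind within_queries_multilevel_alg within_queries.Output assms order_refl)
  then show ?thesis by simp
qed

section \<open>Two inequalities over the reals\<close>

text \<open>The number \<open>h = min 1 (a / b)\<close> satisfies \<open>h * b = min a b\<close>,
  also for \<open>b = 0\<close>. Hence \<open>h * \<beta> = h * (\<beta> - b) + min a b\<close>, and
  this is compared with \<open>min \<alpha> \<beta>\<close>. Damping the error of \<open>a\<close>
  by \<open>min 1 (\<beta> / \<alpha>)\<close> pays off when \<alpha> far exceeds \<beta>.\<close>

lemma min_ratio_error:
  fixes a b \<alpha> \<beta> :: real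
  assumes "a \<ge> 0" "b \<ge> 0" "\<alpha> > 0" "\<beta> > 0"
  shows "\<beta> * \<bar>min 1 (a / b) - min 1 (\<alpha> / \<beta>)\<bar> \<le> 2 * \<bar>b - \<beta>\<bar> + min 1 (\<beta> / \<alpha>) * \<bar>a - \<alpha>\<bar>"
proof -
  define h where "h = min 1 (a / b)"
  have h: "0 \<le> h" "h \<le> 1" "h * b = min a b"
    using assms by (auto simp: h_def min_def field_simps)
  have hb: "\<bar>h * (\<beta> - b)\<bar> \<le> \<bar>b - \<beta>\<bar>"
    using h(1,2) by (simp add: abs_mult mult_left_le_one_le abs_minus_commute)
  show ?thesis
  proof (cases "\<alpha> \<le> \<beta>")
    case True
    then have "\<beta> * \<bar>h - min 1 (\<alpha> / \<beta>)\<bar> = \<bar>h * \<beta> - \<alpha>\<bar>"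
      using assms(3,4) by (auto simp: min_def field_simps abs_mult_pos')
    also have "\<dots> = \<bar>h * (\<beta> - b) + (min a b - \<alpha>)\<bar>"
      using h(3) by (simp add: algebra_simps)
    \<comment> \<open>For \<open>\<alpha> \<le> \<beta>\<close>, the minimum exceeds \<alpha> by at
      most the error of \<open>a\<close>, and falls short of it by at most the error of
      \<open>a\<close> or of \<open>b\<close>.\<close>
    also have "\<dots> \<le> \<bar>b - \<beta>\<bar> + (\<bar>b - \<beta>\<bar> + \<bar>a - \<alpha>\<bar>)"
      using hb True by linarith
    finally show ?thesis using True assms(3) by (simp add: h_def min_def divide_simps)
  next
    case False
    then have "\<beta> * \<bar>h - min 1 (\<alpha> / \<beta>)\<bar> = \<beta> - h * \<beta>"
      using assms(3,4) h(2) by (auto simp: min_def field_simps)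
    also have "\<dots> = (\<beta> - min a b) - h * (\<beta> - b)"
      using h(3) by (simp add: algebra_simps)
    also have "\<dots> \<le> 2 * \<bar>b - \<beta>\<bar> + max 0 (\<beta> - a)"
    proof -
      have "\<beta> - min a b \<le> \<bar>b - \<beta>\<bar> + max 0 (\<beta> - a)" by (auto simp: min_def max_def abs_if)
      with hb show ?thesis by (smt (verit))
    qed
    \<comment> \<open>For \<open>\<beta> < \<alpha>\<close>, shrinking \<open>\<alpha> - a\<close>
      by the factor \<open>\<beta> / \<alpha>\<close> gives
      \<open>\<beta> - \<beta> / \<alpha> * a\<close>, which is still at least
      \<open>\<beta> - a\<close>.\<close>
    also have "max 0 (\<beta> - a) \<le> \<beta> / \<alpha> * \<bar>a - \<alpha>\<bar>"
    proof (cases "a \<le> \<beta>")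
      case True
      have "\<beta> / \<alpha> * \<bar>a - \<alpha>\<bar> = \<beta> - \<beta> / \<alpha> * a"
        using True False assms by (simp add: field_simps)
      moreover have "\<beta> / \<alpha> * a \<le> 1 * a"
        using False assms by (intro mult_right_mono) (auto simp: field_simps)
      ultimately show ?thesis using True by simp
    qed (use assms in simp)
    finally show ?thesis using False assms by (simp add: h_def min_def divide_simps)
  qed
qed

text \<open>A single summand suffices: the one with
  \<open>1 / 2 ^ (j + 1) < r \<le> 1 / 2 ^ j\<close>, or the last one if
  \<open>r \<le> 1 / 2 ^ k\<close>. The indicators turn an expectation into probabilities that
  \<open>prob_rank_le\<close> bounds.\<close>

lemma min_inverse_dyadic:
  fixes r :: real
  assumes "r > 0" "r \<le> 1"
  shows "min 1 (1 / (2 ^ k * r)) \<le> (\<Sum>j\<le>k. 2 / 2 ^ (k - j) * of_bool (r \<le> 1 / 2 ^ j))"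
proof (cases "r \<le> 1 / 2 ^ k")
  case True
  have "min 1 (1 / (2 ^ k * r)) \<le> 2 / 2 ^ (k - k) * of_bool (r \<le> 1 / 2 ^ k)"
    using True by simp
  also have "\<dots> \<le> (\<Sum>j\<le>k. 2 / 2 ^ (k - j) * of_bool (r \<le> 1 / 2 ^ j))"
    by (rule member_le_sum) auto
  finally show ?thesis .
next
  case False
    define i where "i = (LEAST i. \<not> r \<le> 1 / 2 ^ i)"
  have i: "\<not> r \<le> 1 / 2 ^ i" unfolding i_def using False by (rule LeastI)
  have "i \<le> k" unfolding i_def using False by (rule Least_le)
  from i assms(2) obtain j where j: "i = Suc j" by (cases i) auto
  have "r \<le> 1 / 2 ^ j"
    using not_less_Least[of j "\<lambda>i. \<not> r \<le> 1 / 2 ^ i"] j unfolding i_def by auto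
  have "j \<le> k" using j \<open>i \<le> k\<close> by simp
  then have pow: "2 ^ k = 2 ^ (k - j) * (2::real) ^ j" by (simp flip: power_add)
  have "min 1 (1 / (2 ^ k * r)) \<le> 1 / (2 ^ k * r)" by simp
  also have "\<dots> \<le> 2 / 2 ^ (k - j)"
    using i assms(1) by (simp add: j pow field_simps)
  also have "\<dots> = 2 / 2 ^ (k - j) * of_bool (r \<le> 1 / 2 ^ j)"
    using \<open>r \<le> 1 / 2 ^ j\<close> by simp
  also have "\<dots> \<le> (\<Sum>j\<le>k. 2 / 2 ^ (k - j) * of_bool (r \<le> 1 / 2 ^ j))"
    using \<open>j \<le> k\<close> by (intro member_le_sum) auto
  finally show ?thesis .
qed

section \<open>Pairwise comparisons and ranks for a fixed distribution and oracle\<close>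

locale pcond_access =
  fixes N :: nat and D :: "nat pmf" and P :: "nat \<Rightarrow> nat \<Rightarrow> nat pmf"
  assumes N: "N \<ge> 1" and supp: "set_pmf D \<subseteq> {1..N}" and pcond: "pcond_oracle N D P"
begin

lemma finite_supp: "finite (set_pmf D)"
  using supp finite_subset by blast

lemma set_pmf_uniform: "set_pmf (pmf_of_set {1..N}) = {1..N}"
  using N by (intro set_pmf_of_set) auto

text \<open>Outcomes 0 and 1 equal their squares. On the diagonal the constant 1/2 is the value of
  the quotient, and its square is smaller.\<close>

lemma duel:
  assumes "x \<in> {1..N}" "y \<in> {1..N}" "pmf D x + pmf D y > 0"
  shows "finite (set_pmf (run D P (duel x y)))"
    and "set_pmf (run D P (duel x y)) \<subseteq> {0..}"
    and "E (run D P (duel x y)) (\<lambda>v. v) = pmf D x / (pmf D x + pmf D y)"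
    and "E (run D P (duel x y)) (\<lambda>v. v\<^sup>2) \<le> pmf D x / (pmf D x + pmf D y)"
proof -
  have P: "set_pmf (P x y) \<subseteq> {x, y}" "pmf (P x y) x = pmf D x / (pmf D x + pmf D y)" if "x \<noteq> y"
    using pcond assms that by (auto simp: pcond_oracle_def)
  have fin: "finite (set_pmf (P x y))" if "x \<noteq> y"
    using P(1)[OF that] finite_subset by blast
  have win: "E (P x y) (\<lambda>z. of_bool (z = x)) = pmf D x / (pmf D x + pmf D y)" if "x \<noteq> y"
    using P[OF that] that
    by (subst integral_measure_pmf_real[of "{x, y}"]) auto
  show "finite (set_pmf (run D P (duel x y)))" "set_pmf (run D P (duel x y)) \<subseteq> {0..}"
    using fin by (auto simp: duel_def)
  have sq: "(of_bool b)\<^sup>2 = (of_bool b :: real)" for b by simp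
  show "E (run D P (duel x y)) (\<lambda>v. v) = pmf D x / (pmf D x + pmf D y)"
    "E (run D P (duel x y)) (\<lambda>v. v\<^sup>2) \<le> pmf D x / (pmf D x + pmf D y)"
    using assms(3) by (auto simp: duel_def expectation_bind_finite fin win sq power_divide)
qed

definition lose_unif :: "nat \<Rightarrow> real" where
  "lose_unif x = E (pmf_of_set {1..N}) (\<lambda>y. pmf D y / (pmf D y + pmf D x))"

definition win_samp :: "nat \<Rightarrow> real" where
  "win_samp x = E D (\<lambda>y. pmf D x / (pmf D x + pmf D y))"

text \<open>Both sides are sums over \<open>y\<close> of D(x) D(y) / (D(x) + D(y)): weighting by
  \<open>D\<close> supplies the factor D(y), which a defeat by a uniform \<open>y\<close> already
  contains.\<close>

lemma win_samp_eq: "win_samp x = real N * pmf D x * lose_unif x"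
proof -
  have "lose_unif x = (\<Sum>y\<in>{1..N}. pmf D y / (pmf D y + pmf D x)) / N"
    unfolding lose_unif_def using N by (subst integral_pmf_of_set) auto
  moreover have "win_samp x = (\<Sum>y\<in>{1..N}. pmf D x / (pmf D x + pmf D y) * pmf D y)"
    unfolding win_samp_def using supp by (intro integral_measure_pmf_real) auto
  moreover have "\<dots> = pmf D x * (\<Sum>y\<in>{1..N}. pmf D y / (pmf D y + pmf D x))"
    by (simp add: sum_distrib_left mult_ac add.commute)
  ultimately show ?thesis using N by simp
qed

lemma pmf_pos: "x \<in> set_pmf D \<Longrightarrow> pmf D x > 0"
  by (simp add: pmf_positive)

definition rank :: "nat \<Rightarrow> real" where
  "rank x = measure_pmf.prob D {y. pmf D y \<le> pmf D x}"

lemma rank_le_1: "rank x \<le> 1"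
  by (simp add: rank_def)

lemma rank_pos:
  assumes "x \<in> set_pmf D"
  shows "rank x > 0"
proof -
  have "pmf D x \<le> rank x"
    unfolding rank_def measure_pmf_single[symmetric]
    by (intro measure_pmf.finite_measure_mono) auto
  with pmf_pos[OF assms] show ?thesis by simp
qed

text \<open>Against an opponent that is no heavier, \<open>x\<close> wins with probability at least
  1/2.\<close>

lemma rank_le_win_samp:
  assumes "x \<in> set_pmf D"
  shows "rank x / 2 \<le> win_samp x"
proof -
  have "rank x = E D (\<lambda>y. indicator {y. pmf D y \<le> pmf D x} y)"
    by (simp add: rank_def)
  then have "rank x / 2 = E D (\<lambda>y. indicator {y. pmf D y \<le> pmf D x} y / 2)"
    by simp
  also have "\<dots> \<le> win_samp x"
    unfolding win_samp_def
  proof (rule expectation_mono_finite[OF finite_supp])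
    fix y
    show "indicator {y. pmf D y \<le> pmf D x} y / 2 \<le> pmf D x / (pmf D x + pmf D y)"
      using pmf_pos[OF assms] by (auto simp: indicator_def field_simps add_pos_nonneg)
  qed
  finally show ?thesis .
qed

lemma win_samp_pos: "x \<in> set_pmf D \<Longrightarrow> win_samp x > 0"
  using rank_le_win_samp[of x] rank_pos[of x] by simp

lemma lose_unif_pos:
  assumes "x \<in> set_pmf D"
  shows "lose_unif x > 0"
  using win_samp_pos[OF assms] pmf_pos[OF assms] N by (simp add: win_samp_eq zero_less_mult_iff mult_less_0_iff)

text \<open>All elements of the support with rank at most \<open>t\<close> are no heavier than the
  heaviest of them, so their total mass is at most its rank.\<close>

lemma prob_rank_le:
  assumes "t \<ge> 0"
  shows "measure_pmf.prob D {x. rank x \<le> t} \<le> t"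
proof (cases "set_pmf D \<inter> {x. rank x \<le> t} = {}")
  case True
  then have "measure_pmf.prob D {x. rank x \<le> t} = 0"
    by (auto simp: measure_pmf_zero_iff)
  with assms show ?thesis by simp
next
  case False
  define S where "S = set_pmf D \<inter> {x. rank x \<le> t}"
  have "finite S" "S \<noteq> {}" using False finite_supp by (auto simp: S_def)
  then have "Max (pmf D ` S) \<in> pmf D ` S" by (intro Max_in) auto
  then obtain x where "x \<in> S" and Max: "Max (pmf D ` S) = pmf D x" by auto
  then have x: "x \<in> S" "pmf D y \<le> pmf D x" if "y \<in> S" for y
    using \<open>finite S\<close> that by (auto simp flip: Max)
  have "measure_pmf.prob D {x. rank x \<le> t} = measure_pmf.prob D S"
    unfolding S_def by (subst Int_commute) (simp add: measure_Int_set_pmf)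
  also have "\<dots> \<le> rank x"
    unfolding rank_def using x by (intro measure_pmf.finite_measure_mono) auto
  also have "\<dots> \<le> t" using \<open>x \<in> S\<close> by (simp add: S_def)
  finally show ?thesis .
qed

section \<open>Mean square error of the ratio estimate\<close>

text \<open>The second moment of a duel is at most its mean, so the mean also bounds the variance. A
  constant variance bound for the coins would degrade the error to order 1 / (n B^2) with B =
  \<open>win_samp x\<close>, instead of 1 / (n B).\<close>

lemma uniform_coin:
  assumes "x \<in> set_pmf D"
  shows "moments (run D P (uniform_coin N x)) (lose_unif x) (lose_unif x)"
    and "set_pmf (run D P (uniform_coin N x)) \<subseteq> {0..}"
proof -
  have x: "x \<in> {1..N}" "\<And>y. pmf D y + pmf D x > 0"
    using assms supp pmf_pos[OF assms] by (auto intro: add_nonneg_pos)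
  note d = duel[OF _ x]
  have fin: "finite (set_pmf (run D P (uniform_coin N x)))"
    using d(1) by (simp add: uniform_coin_def set_pmf_uniform del: One_nat_def)
  have ev: "E (run D P (uniform_coin N x)) h
      = E (pmf_of_set {1..N}) (\<lambda>y. E (run D P (duel y x)) h)" for h
    unfolding uniform_coin_def run.simps
    by (rule expectation_bind_finite) (use d(1) set_pmf_uniform in \<open>auto simp del: One_nat_def\<close>)
  show "moments (run D P (uniform_coin N x)) (lose_unif x) (lose_unif x)"
    unfolding lose_unif_def
  proof (rule moments_of_square[OF fin])
    show "E (run D P (uniform_coin N x)) (\<lambda>v. v)
        = E (pmf_of_set {1..N}) (\<lambda>y. pmf D y / (pmf D y + pmf D x))"
      unfolding ev by (rule expectation_cong_pmf) (use d(3) set_pmf_uniform in \<open>auto simp del: One_nat_def\<close>)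
    show "E (run D P (uniform_coin N x)) (\<lambda>v. v\<^sup>2)
        \<le> E (pmf_of_set {1..N}) (\<lambda>y. pmf D y / (pmf D y + pmf D x))"
      unfolding ev by (rule expectation_mono_finite) (use d(4) set_pmf_uniform in \<open>auto simp del: One_nat_def\<close>)
  qed
  show "set_pmf (run D P (uniform_coin N x)) \<subseteq> {0..}"
    using d(2) by (force simp: uniform_coin_def set_pmf_uniform simp del: One_nat_def)
qed

lemma sample_coin:
  assumes "x \<in> set_pmf D"
  shows "moments (run D P (sample_coin x)) (win_samp x) (win_samp x)"
    and "set_pmf (run D P (sample_coin x)) \<subseteq> {0..}"
proof -
  have x: "x \<in> {1..N}" "\<And>y. pmf D x + pmf D y > 0"
    using assms supp pmf_pos[OF assms] by (auto intro: add_pos_nonneg)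
  have d: "y \<in> set_pmf D \<Longrightarrow> y \<in> {1..N}" for y
    using supp by auto
  note d = duel[OF x(1) d x(2)]
  have fin: "finite (set_pmf (run D P (sample_coin x)))"
    using d(1) finite_supp by (auto simp: sample_coin_def)
  have ev: "E (run D P (sample_coin x)) h = E D (\<lambda>y. E (run D P (duel x y)) h)" for h
    using d(1) finite_supp by (simp add: sample_coin_def expectation_bind_finite)
  show "moments (run D P (sample_coin x)) (win_samp x) (win_samp x)"
    unfolding win_samp_def
  proof (rule moments_of_square[OF fin])
    show "E (run D P (sample_coin x)) (\<lambda>v. v) = E D (\<lambda>y. pmf D x / (pmf D x + pmf D y))"
      unfolding ev by (rule expectation_cong_pmf) (use d(3) in auto)
    show "E (run D P (sample_coin x)) (\<lambda>v. v\<^sup>2) \<le> E D (\<lambda>y. pmf D x / (pmf D x + pmf D y))"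
      unfolding ev by (rule expectation_mono_finite) (use d(4) finite_supp in auto)
  qed
  show "set_pmf (run D P (sample_coin x)) \<subseteq> {0..}"
    using d(2) by (force simp: sample_coin_def)
qed

text \<open>On the support of \<open>D\<close> this is min(1, 1 / (N D(x))), by
  \<open>win_samp_eq\<close>.\<close>

definition capped_ratio :: "nat \<Rightarrow> real" where
  "capped_ratio x = min 1 (lose_unif x / win_samp x)"

lemma ratio_alg_range:
  assumes "x \<in> set_pmf D"
  shows "finite (set_pmf (run D P (ratio_alg N n x)))"
    and "set_pmf (run D P (ratio_alg N n x)) \<subseteq> {0..1}"
proof -
  note u = moments_sum_runs[OF uniform_coin(1)[OF assms], of n]
    set_pmf_sum_runs_nonneg[OF uniform_coin(2)[OF assms], of n]
  note s = moments_sum_runs[OF sample_coin(1)[OF assms], of n]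
    set_pmf_sum_runs_nonneg[OF sample_coin(2)[OF assms], of n]
  show "finite (set_pmf (run D P (ratio_alg N n x)))"
    using momentsD(1)[OF u(1)] momentsD(1)[OF s(1)] by (simp add: ratio_alg_def run_bind_alg)
  show "set_pmf (run D P (ratio_alg N n x)) \<subseteq> {0..1}"
    using u(2) s(2) by (fastforce simp: ratio_alg_def run_bind_alg)
qed

text \<open>Squaring \<open>min_ratio_error\<close> gives weights 8 and 2 c^2 for the two variances
  \<beta> and \<alpha>; the sum is at most 10 \<beta>, to be divided by \<beta>^2.\<close>

lemma ratio_alg_error:
  assumes x: "x \<in> set_pmf D" and n: "n > 0"
  shows "E (run D P (ratio_alg N n x)) (\<lambda>h. (h - capped_ratio x)\<^sup>2) \<le> 10 / (real n * win_samp x)"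
proof -
  define p where "p = run D P (sum_runs n (uniform_coin N x))"
  define q where "q = run D P (sum_runs n (sample_coin x))"
  define \<alpha> where "\<alpha> = real n * lose_unif x"
  define \<beta> where "\<beta> = real n * win_samp x"
  define c where "c = min 1 (\<beta> / \<alpha>)"
  have p: "moments p \<alpha> \<alpha>" "set_pmf p \<subseteq> {0..}"
    unfolding p_def \<alpha>_def by (intro moments_sum_runs set_pmf_sum_runs_nonneg uniform_coin x)+
  have q: "moments q \<beta> \<beta>" "set_pmf q \<subseteq> {0..}"
    unfolding q_def \<beta>_def by (intro moments_sum_runs set_pmf_sum_runs_nonneg sample_coin x)+
  note fp = momentsD(1)[OF p(1)] and fq = momentsD(1)[OF q(1)]
  note int = integrable_measure_pmf_finite[OF fp] integrable_measure_pmf_finite[OF fq]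
  have pos: "\<alpha> > 0" "\<beta> > 0"
    unfolding \<alpha>_def \<beta>_def using n lose_unif_pos[OF x] win_samp_pos[OF x] by auto
  have g: "capped_ratio x = min 1 (\<alpha> / \<beta>)"
    using n by (simp add: capped_ratio_def \<alpha>_def \<beta>_def)
  have pw: "\<beta>\<^sup>2 * (min 1 (a / b) - capped_ratio x)\<^sup>2 \<le> 8 * (b - \<beta>)\<^sup>2 + 2 * c\<^sup>2 * (a - \<alpha>)\<^sup>2"
    if "a \<in> set_pmf p" "b \<in> set_pmf q" for a b
  proof -
    have "\<beta>\<^sup>2 * (min 1 (a / b) - capped_ratio x)\<^sup>2 = (\<beta> * \<bar>min 1 (a / b) - capped_ratio x\<bar>)\<^sup>2"
      by (simp add: power_mult_distrib)
    also have "\<dots> \<le> (2 * \<bar>b - \<beta>\<bar> + c * \<bar>a - \<alpha>\<bar>)\<^sup>2"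
      unfolding g c_def using that p(2) q(2) pos
      by (intro power_mono min_ratio_error) auto
    also have "\<dots> \<le> 2 * (2 * \<bar>b - \<beta>\<bar>)\<^sup>2 + 2 * (c * \<bar>a - \<alpha>\<bar>)\<^sup>2"
      using sum_squares_bound[of "2 * \<bar>b - \<beta>\<bar>" "c * \<bar>a - \<alpha>\<bar>"] by (simp add: power2_sum)
    finally show ?thesis by (simp add: power_mult_distrib)
  qed
  \<comment> \<open>The damping factor absorbs the variance of the numerator even if \<alpha> is
    much larger than \<beta>.\<close>
  have c2: "c\<^sup>2 * \<alpha> \<le> \<beta>"
  proof -
    have "0 \<le> c" "c \<le> 1" using pos by (auto simp: c_def)
    then have "c\<^sup>2 * \<alpha> \<le> c * \<alpha>"
      using pos by (intro mult_right_mono) (auto simp: power2_eq_square mult_left_le_one_le)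
    also have "\<dots> \<le> \<beta> / \<alpha> * \<alpha>"
      using pos by (intro mult_right_mono) (auto simp: c_def)
    finally show ?thesis using pos by simp
  qed
  have "E (run D P (ratio_alg N n x)) (\<lambda>h. (h - capped_ratio x)\<^sup>2)
      = E p (\<lambda>a. E q (\<lambda>b. (min 1 (a / b) - capped_ratio x)\<^sup>2))"
    using fp fq unfolding ratio_alg_def p_def q_def
    by (simp add: run_bind_alg expectation_bind_finite)
  then have "\<beta>\<^sup>2 * E (run D P (ratio_alg N n x)) (\<lambda>h. (h - capped_ratio x)\<^sup>2)
      = E p (\<lambda>a. E q (\<lambda>b. \<beta>\<^sup>2 * (min 1 (a / b) - capped_ratio x)\<^sup>2))"
    by simp
  also have "\<dots> \<le> E p (\<lambda>a. E q (\<lambda>b. 8 * (b - \<beta>)\<^sup>2 + 2 * c\<^sup>2 * (a - \<alpha>)\<^sup>2))"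
    by (intro expectation_mono_finite fp fq pw)
  also have "\<dots> = 8 * E q (\<lambda>b. (b - \<beta>)\<^sup>2) + 2 * c\<^sup>2 * E p (\<lambda>a. (a - \<alpha>)\<^sup>2)"
    by (simp add: int)
  also have "\<dots> \<le> 8 * \<beta> + 2 * c\<^sup>2 * \<alpha>"
    using momentsD(3)[OF p(1)] momentsD(3)[OF q(1)] by (intro add_mono mult_left_mono) auto
  also have "\<dots> \<le> 10 * \<beta>" using c2 by simp
  finally have "\<beta>\<^sup>2 * E (run D P (ratio_alg N n x)) (\<lambda>h. (h - capped_ratio x)\<^sup>2) \<le> 10 * \<beta>" .
  then show ?thesis
    using pos unfolding \<beta>_def[symmetric] by (simp add: field_simps power2_eq_square)
qed

definition ratio_mse :: "nat \<Rightarrow> real" where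
  "ratio_mse n = E D (\<lambda>x. E (run D P (ratio_alg N n x)) (\<lambda>h. (h - capped_ratio x)\<^sup>2))"

definition ratio_mean :: "nat \<Rightarrow> real" where
  "ratio_mean n = E D (\<lambda>x. E (run D P (ratio_alg N n x)) (\<lambda>h. h))"

lemma capped_ratio_range:
  assumes "x \<in> set_pmf D"
  shows "capped_ratio x \<in> {0..1}"
  using lose_unif_pos[OF assms] win_samp_pos[OF assms] by (simp add: capped_ratio_def)

lemma ratio_alg_error_le_1:
  assumes "x \<in> set_pmf D"
  shows "E (run D P (ratio_alg N n x)) (\<lambda>h. (h - capped_ratio x)\<^sup>2) \<le> 1"
proof -
  have "E (run D P (ratio_alg N n x)) (\<lambda>h. (h - capped_ratio x)\<^sup>2)
      \<le> E (run D P (ratio_alg N n x)) (\<lambda>h. 1)"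
    using ratio_alg_range[OF assms, of n] capped_ratio_range[OF assms]
    by (intro expectation_mono_finite) (force simp: abs_square_le_1)+
  then show ?thesis by simp
qed

lemma ratio_mse_le_1: "ratio_mse n \<le> 1"
proof -
  have "ratio_mse n \<le> E D (\<lambda>x. 1)"
    unfolding ratio_mse_def by (intro expectation_mono_finite finite_supp ratio_alg_error_le_1)
  then show ?thesis by simp
qed

text \<open>The error at \<open>x\<close> is at most 20 min(1, 1 / (2^k rank)). Each of the
  \<open>k + 1\<close> dyadic scales of the rank contributes 40 / 2^(k-j) times a probability of at
  most 1 / 2^j.\<close>

lemma ratio_mse_pow2: "ratio_mse (2 ^ k) \<le> 40 * real (Suc k) / 2 ^ k"
proof -
  have pw: "E (run D P (ratio_alg N (2 ^ k) x)) (\<lambda>h. (h - capped_ratio x)\<^sup>2)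
      \<le> (\<Sum>j\<le>k. 40 / 2 ^ (k - j) * of_bool (rank x \<le> 1 / 2 ^ j))" if x: "x \<in> set_pmf D" for x
  proof -
    have "E (run D P (ratio_alg N (2 ^ k) x)) (\<lambda>h. (h - capped_ratio x)\<^sup>2)
        \<le> 10 / (2 ^ k * win_samp x)"
      using ratio_alg_error[OF x, of "2 ^ k"] by simp
    also have "\<dots> \<le> 10 / (2 ^ k * (rank x / 2))"
      using rank_le_win_samp[OF x] rank_pos[OF x] by (intro divide_left_mono) auto
    finally have "E (run D P (ratio_alg N (2 ^ k) x)) (\<lambda>h. (h - capped_ratio x)\<^sup>2)
        \<le> 20 * min 1 (1 / (2 ^ k * rank x))"
      using ratio_alg_error_le_1[OF x, of "2 ^ k"] by (simp add: min_def)
    also have "\<dots> \<le> 20 * (\<Sum>j\<le>k. 2 / 2 ^ (k - j) * of_bool (rank x \<le> 1 / 2 ^ j))"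
      using min_inverse_dyadic[OF rank_pos[OF x] rank_le_1, of k] by simp
    finally show ?thesis by (simp add: sum_distrib_left mult.assoc)
  qed
  have "ratio_mse (2 ^ k) \<le> E D (\<lambda>x. \<Sum>j\<le>k. 40 / 2 ^ (k - j) * of_bool (rank x \<le> 1 / 2 ^ j))"
    unfolding ratio_mse_def by (intro expectation_mono_finite finite_supp pw)
  also have "\<dots> = (\<Sum>j\<le>k. 40 / 2 ^ (k - j) * measure_pmf.prob D {x. rank x \<le> 1 / 2 ^ j})"
    by (simp add: integrable_measure_pmf_finite[OF finite_supp] expectation_of_bool)
  also have "\<dots> \<le> (\<Sum>j\<le>k. 40 / 2 ^ (k - j) * (1 / 2 ^ j))"
    by (intro sum_mono mult_left_mono prob_rank_le) auto
  also have "\<dots> = (\<Sum>j\<le>k. 40 / 2 ^ k)"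
    by (intro sum.cong) (auto simp flip: power_add)
  finally show ?thesis by (simp add: algebra_simps)
qed

text \<open>Halving the rounds doubles the constant. For \<open>k = 0\<close> there are no rounds
  and the trivial bound 1 is used.\<close>

lemma ratio_mse_pow2_half: "ratio_mse (2 ^ k div 2) \<le> 80 * real (Suc k) / 2 ^ k"
proof (cases k)
  case 0
  then show ?thesis using ratio_mse_le_1[of 0] by simp
next
  case (Suc j)
  then show ?thesis using ratio_mse_pow2[of j] by (simp add: field_simps)
qed

section \<open>Moments of the multilevel estimator\<close>

text \<open>Both estimates use the same \<open>x\<close> and so approximate the same
  \<open>capped_ratio x\<close>; their squared difference is at most twice the sum of the squared
  errors, whence 240 = 2 * 40 + 2 * 80.\<close>

lemma level_alg_moments:
  "moments (run D P (level_alg N k)) (ratio_mean (2 ^ k) - ratio_mean (2 ^ k div 2))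
    (240 * real (Suc k) / 2 ^ k)"
proof (rule moments_of_square)
  note fin = ratio_alg_range(1)
  note int = integrable_measure_pmf_finite[OF fin] integrable_measure_pmf_finite[OF finite_supp]
  define p where "p n x = run D P (ratio_alg N n x)" for n x
  let ?a = "2 ^ k :: nat" and ?b = "2 ^ k div 2 :: nat"
  show "finite (set_pmf (run D P (level_alg N k)))"
    using fin finite_supp by (simp add: level_alg_def run_bind_alg)
  have ev: "E (run D P (level_alg N k)) f = E D (\<lambda>x. E (p ?a x) (\<lambda>h. E (p ?b x) (\<lambda>h'. f (h - h'))))" for f
  proof -
    have "E (run D P (level_alg N k)) f = E D (\<lambda>x. E (bind_pmf (p ?a x) (\<lambda>h.
        bind_pmf (p ?b x) (\<lambda>h'. return_pmf (h - h')))) f)"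
      unfolding level_alg_def p_def using fin finite_supp
      by (simp add: run_bind_alg expectation_bind_finite)
    also have "\<dots> = E D (\<lambda>x. E (p ?a x) (\<lambda>h. E (p ?b x) (\<lambda>h'. f (h - h'))))"
      unfolding p_def
      by (rule expectation_cong_pmf) (simp add: expectation_bind_finite fin)
    finally show ?thesis .
  qed
  have "E (run D P (level_alg N k)) (\<lambda>v. v)
      = E D (\<lambda>x. E (p ?a x) (\<lambda>h. h) - E (p ?b x) (\<lambda>h. h))"
    unfolding ev p_def by (rule expectation_cong_pmf) (simp add: int)
  then show "E (run D P (level_alg N k)) (\<lambda>v. v) = ratio_mean ?a - ratio_mean ?b"
    by (simp add: int ratio_mean_def p_def)
  have "E (run D P (level_alg N k)) (\<lambda>v. v\<^sup>2)
      \<le> E D (\<lambda>x. 2 * E (p ?a x) (\<lambda>h. (h - capped_ratio x)\<^sup>2)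
               + 2 * E (p ?b x) (\<lambda>h. (h - capped_ratio x)\<^sup>2))"
    unfolding ev
  proof (rule expectation_mono_finite[OF finite_supp])
    fix x assume x: "x \<in> set_pmf D"
    have "E (p ?a x) (\<lambda>h. E (p ?b x) (\<lambda>h'. (h - h')\<^sup>2))
        \<le> E (p ?a x) (\<lambda>h. E (p ?b x) (\<lambda>h'. 2 * (h - capped_ratio x)\<^sup>2 + 2 * (h' - capped_ratio x)\<^sup>2))"
      unfolding p_def
    proof (intro expectation_mono_finite fin x)
      fix h h' :: real
      show "(h - h')\<^sup>2 \<le> 2 * (h - capped_ratio x)\<^sup>2 + 2 * (h' - capped_ratio x)\<^sup>2"
        using zero_le_power2[of "(h - capped_ratio x) + (h' - capped_ratio x)"]
        by (simp add: power2_eq_square algebra_simps)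
    qed
    also have "\<dots> = 2 * E (p ?a x) (\<lambda>h. (h - capped_ratio x)\<^sup>2)
               + 2 * E (p ?b x) (\<lambda>h. (h - capped_ratio x)\<^sup>2)"
      unfolding p_def using x by (simp add: int)
    finally show "E (p ?a x) (\<lambda>h. E (p ?b x) (\<lambda>h'. (h - h')\<^sup>2)) \<le> \<dots>" .
  qed
  also have "\<dots> = 2 * ratio_mse ?a + 2 * ratio_mse ?b"
    by (simp add: int ratio_mse_def p_def)
  also have "\<dots> \<le> 2 * (40 * real (Suc k) / 2 ^ k) + 2 * (80 * real (Suc k) / 2 ^ k)"
    by (intro add_mono mult_left_mono ratio_mse_pow2 ratio_mse_pow2_half) auto
  finally show "E (run D P (level_alg N k)) (\<lambda>v. v\<^sup>2) \<le> 240 * real (Suc k) / 2 ^ k"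
    by (simp add: add_divide_distrib)
qed

lemma ratio_mean_0: "ratio_mean 0 = 0"
  by (simp add: ratio_mean_def ratio_alg_def)

text \<open>Averaging \<open>2 ^ (L - k)\<close> copies turns the denominator \<open>2 ^ k\<close>
  of the variance into \<open>2 ^ L\<close>. Replacing \<open>Suc k\<close> by \<open>Suc L\<close>
  makes the increment the same on every level.\<close>

lemma multilevel_alg_step:
  assumes "moments (run D P (multilevel_alg N L k)) m v" "k \<le> L"
  shows "moments (run D P (multilevel_alg N L (Suc k)))
    (m + (ratio_mean (2 ^ k) - ratio_mean (2 ^ k div 2))) (v + 240 * real (Suc L) / 2 ^ L)"
proof -
  let ?c = "1 / 2 ^ (L - k) :: real"
  let ?m = "ratio_mean (2 ^ k) - ratio_mean (2 ^ k div 2)"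
  have "moments (run D P (sum_runs (2 ^ (L - k)) (level_alg N k)))
      (2 ^ (L - k) * ?m) (2 ^ (L - k) * (240 * real (Suc k) / 2 ^ k))"
    using moments_sum_runs[OF level_alg_moments, of "2 ^ (L - k)" k] by simp
  from moments_add[OF assms(1) this, of ?c]
  have "moments (run D P (multilevel_alg N L (Suc k))) (m + ?m)
      (v + ?c\<^sup>2 * (2 ^ (L - k) * (240 * real (Suc k) / 2 ^ k)))"
    by (simp add: run_bind_alg)
  moreover have "(2::real) ^ L = 2 ^ (L - k) * 2 ^ k" using assms(2) by (simp flip: power_add)
  then have "?c\<^sup>2 * (2 ^ (L - k) * (240 * real (Suc k) / 2 ^ k)) \<le> 240 * real (Suc L) / 2 ^ L"
    using assms(2) by (simp add: power2_eq_square field_simps)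
  ultimately show ?thesis unfolding moments_def by linarith
qed

lemma multilevel_alg_moments:
  "k \<le> L \<Longrightarrow> moments (run D P (multilevel_alg N L (Suc k))) (ratio_mean (2 ^ k))
    (real (Suc k) * (240 * real (Suc L) / 2 ^ L))"
proof (induction k)
  case 0
  have "moments (run D P (multilevel_alg N L 0)) 0 0" by (simp add: moments_def)
  from multilevel_alg_step[OF this] show ?case by (simp add: ratio_mean_0)
next
  case (Suc k)
  have "real (Suc k) * r + r = real (Suc (Suc k)) * r" for r by (simp add: algebra_simps)
  moreover have "ratio_mean (2 ^ k) + (ratio_mean (2 ^ Suc k) - ratio_mean (2 ^ Suc k div 2))
      = ratio_mean (2 ^ Suc k)" by simp
  ultimately show ?case
    using multilevel_alg_step[OF Suc.IH Suc.prems] Suc.prems by (simp only: Suc_leD)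
qed

section \<open>Total variation distance and the success probability\<close>

text \<open>Apply |u - v| = u + v - 2 min(u, v) with v = 1/N; weighting \<open>capped_ratio\<close>
  by \<open>D\<close> gives exactly these minima, which vanish off the support.\<close>

lemma tv_dist_uniform: "tv_dist N D (pmf_of_set {1..N}) = 1 - E D capped_ratio"
proof -
  have "E D capped_ratio = (\<Sum>i\<in>{1..N}. capped_ratio i * pmf D i)"
    using supp by (intro integral_measure_pmf_real) auto
  also have "\<dots> = (\<Sum>i\<in>{1..N}. min (pmf D i) (1 / N))"
  proof (rule sum.cong)
    fix i
    show "capped_ratio i * pmf D i = min (pmf D i) (1 / N)"
    proof (cases "i \<in> set_pmf D")
      case True
      then show ?thesis
        using pmf_pos[OF True] lose_unif_pos[OF True] N
        by (simp add: capped_ratio_def win_samp_eq min_def field_simps)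
    qed (simp add: set_pmf_eq)
  qed simp
  finally have T: "E D capped_ratio = (\<Sum>i\<in>{1..N}. min (pmf D i) (1 / N))" .
  have "tv_dist N D (pmf_of_set {1..N}) = 1 / 2 * (\<Sum>i\<in>{1..N}. \<bar>pmf D i - 1 / N\<bar>)"
    unfolding tv_dist_def using N by (auto intro!: sum.cong simp: pmf_of_set)
  also have "\<dots> = 1 / 2 * (\<Sum>i\<in>{1..N}. pmf D i + 1 / N - 2 * min (pmf D i) (1 / N))"
    by (intro arg_cong[where f = "\<lambda>s. 1 / 2 * s"] sum.cong) (auto simp: min_def)
  also have "\<dots> = 1 / 2 * ((\<Sum>i\<in>{1..N}. pmf D i) + 1 - 2 * E D capped_ratio)"
    using N by (simp add: sum.distrib sum_subtractf T sum_distrib_left)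
  also have "(\<Sum>i\<in>{1..N}. pmf D i) = 1"
    using supp by (intro sum_pmf_eq_1) auto
  finally show ?thesis by simp
qed

text \<open>Variance plus squared bias, 280 = 240 + 40. By Jensen's inequality the squared bias is
  at most the mean square error on the finest level.\<close>

lemma tv_alg_error:
  "E (run D P (tv_alg N L)) (\<lambda>v. (v - tv_dist N D (pmf_of_set {1..N}))\<^sup>2)
    \<le> 280 * (real (Suc L))\<^sup>2 / 2 ^ L"
proof -
  define p where "p = run D P (multilevel_alg N L (Suc L))"
  define T where "T = E D capped_ratio"
  define M where "M = ratio_mean (2 ^ L)"
  have p: "moments p M (real (Suc L) * (240 * real (Suc L) / 2 ^ L))"
    unfolding p_def M_def by (rule multilevel_alg_moments) simp
  note int = integrable_measure_pmf_finite[OF momentsD(1)[OF p]]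
    integrable_measure_pmf_finite[OF finite_supp] integrable_measure_pmf_finite[OF ratio_alg_range(1)]
  have "(M - T)\<^sup>2 \<le> ratio_mse (2 ^ L)"
  proof -
    have "M - T = E D (\<lambda>x. E (run D P (ratio_alg N (2 ^ L) x)) (\<lambda>h. h) - capped_ratio x)"
      by (simp add: M_def T_def ratio_mean_def int)
    also have "\<dots> = E D (\<lambda>x. E (run D P (ratio_alg N (2 ^ L) x)) (\<lambda>h. h - capped_ratio x))"
      by (rule expectation_cong_pmf) (simp add: int)
    finally have "(M - T)\<^sup>2
        \<le> E D (\<lambda>x. (E (run D P (ratio_alg N (2 ^ L) x)) (\<lambda>h. h - capped_ratio x))\<^sup>2)"
      using expectation_square_le[OF finite_supp] by simp
    also have "\<dots> \<le> ratio_mse (2 ^ L)"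
      unfolding ratio_mse_def
      by (intro expectation_mono_finite finite_supp expectation_square_le ratio_alg_range)
    finally show ?thesis .
  qed
  also have "\<dots> \<le> 40 * real (Suc L) / 2 ^ L" by (rule ratio_mse_pow2)
  also have "\<dots> \<le> 40 * (real (Suc L))\<^sup>2 / 2 ^ L"
    by (intro divide_right_mono mult_left_mono self_le_power) auto
  finally have bias: "(M - T)\<^sup>2 \<le> 40 * (real (Suc L))\<^sup>2 / 2 ^ L" .
  have "E (run D P (tv_alg N L)) (\<lambda>v. (v - tv_dist N D (pmf_of_set {1..N}))\<^sup>2)
      = E p (\<lambda>s. (s - T)\<^sup>2)"
    using momentsD(1)[OF p] unfolding tv_alg_def tv_dist_uniform p_def T_def
    by (simp del: multilevel_alg.simps add: run_bind_alg expectation_bind_finite power2_commute)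
  also have "\<dots> = E p (\<lambda>s. (s - M)\<^sup>2 + (2 * (M - T)) * (s - M) + (M - T)\<^sup>2)"
    by (rule arg_cong[where f = "E p"]) (auto simp: power2_eq_square algebra_simps)
  also have "\<dots> = E p (\<lambda>s. (s - M)\<^sup>2) + (2 * (M - T)) * E p (\<lambda>s. s - M) + (M - T)\<^sup>2"
    by (simp add: int del: Bochner_Integration.integral_diff)
  also have "E p (\<lambda>s. s - M) = 0"
    using momentsD(2)[OF p] by (simp add: int)
  also have "E p (\<lambda>s. (s - M)\<^sup>2) + 2 * (M - T) * 0 + (M - T)\<^sup>2
      \<le> real (Suc L) * (240 * real (Suc L) / 2 ^ L) + 40 * (real (Suc L))\<^sup>2 / 2 ^ L"
    using momentsD(3)[OF p] bias by simp
  also have "\<dots> = 280 * (real (Suc L))\<^sup>2 / 2 ^ L"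
    by (simp add: power2_eq_square add_divide_distrib[symmetric] del: of_nat_Suc)
  finally show ?thesis .
qed

text \<open>Chebyshev's argument about the true distance; 840 = 3 * 280 leaves failure probability
  1/3.\<close>

lemma tv_alg_correct:
  assumes "\<epsilon> > 0" "840 * (real (Suc L))\<^sup>2 \<le> \<epsilon>\<^sup>2 * 2 ^ L"
  shows "measure_pmf.prob (run D P (tv_alg N L))
    {v. \<bar>v - tv_dist N D (pmf_of_set {1..N})\<bar> \<le> \<epsilon>} \<ge> 2 / 3"
proof -
  let ?p = "run D P (tv_alg N L)" and ?t = "tv_dist N D (pmf_of_set {1..N})"
  have fin: "finite (set_pmf ?p)"
    using momentsD(1)[OF multilevel_alg_moments[of L L]]
    by (simp del: multilevel_alg.simps add: tv_alg_def run_bind_alg)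
  have "\<epsilon>\<^sup>2 * measure_pmf.prob ?p {v. \<not> \<bar>v - ?t\<bar> \<le> \<epsilon>}
      = E ?p (\<lambda>v. \<epsilon>\<^sup>2 * of_bool (\<not> \<bar>v - ?t\<bar> \<le> \<epsilon>))"
    by (simp add: expectation_of_bool)
  also have "\<dots> \<le> E ?p (\<lambda>v. (v - ?t)\<^sup>2)"
    using assms(1) by (intro expectation_mono_finite fin) (auto simp: abs_le_square_iff[symmetric])
  also have "\<dots> \<le> 280 * (real (Suc L))\<^sup>2 / 2 ^ L" by (rule tv_alg_error)
  also have "\<dots> \<le> \<epsilon>\<^sup>2 * (1 / 3)" using assms(2) by (simp add: field_simps)
  finally have "measure_pmf.prob ?p {v. \<not> \<bar>v - ?t\<bar> \<le> \<epsilon>} \<le> 1 / 3"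
    using assms(1) by (simp only: mult_le_cancel_left_pos zero_less_power)
  moreover have "measure_pmf.prob ?p {v. \<not> \<bar>v - ?t\<bar> \<le> \<epsilon>}
      = 1 - measure_pmf.prob ?p {v. \<bar>v - ?t\<bar> \<le> \<epsilon>}"
    using measure_pmf.prob_compl[of "{v. \<bar>v - ?t\<bar> \<le> \<epsilon>}" ?p] by (simp add: Compl_eq_Diff_UNIV[symmetric] Collect_neg_eq)
  ultimately show ?thesis by simp
qed

end

section \<open>Choice of the number of levels\<close>

text \<open>Minimality matters: it is what bounds the cost from above.\<close>

definition depth :: "real \<Rightarrow> nat" where
  "depth \<epsilon> = (LEAST L. 840 * (real (Suc L))\<^sup>2 \<le> \<epsilon>\<^sup>2 * 2 ^ L)"

lemma depth:
  assumes "0 < \<epsilon>" "\<epsilon> < 1"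
  shows "840 * (real (Suc (depth \<epsilon>)))\<^sup>2 \<le> \<epsilon>\<^sup>2 * 2 ^ depth \<epsilon>"
    and "depth \<epsilon> \<ge> 1"
    and "\<epsilon>\<^sup>2 * 2 ^ depth \<epsilon> \<le> 1680 * (real (depth \<epsilon>))\<^sup>2"
proof -
  have "(\<lambda>L. (real (Suc L))\<^sup>2 / 2 ^ L) \<longlonglongrightarrow> 0" by real_asymp
  then have "\<forall>\<^sub>F L in sequentially. (real (Suc L))\<^sup>2 / 2 ^ L < \<epsilon>\<^sup>2 / 840"
    using assms by (intro order_tendstoD) auto
  then obtain L where "(real (Suc L))\<^sup>2 / 2 ^ L < \<epsilon>\<^sup>2 / 840"
    by (auto simp: eventually_sequentially)
  then have "840 * (real (Suc L))\<^sup>2 \<le> \<epsilon>\<^sup>2 * 2 ^ L" by (simp add: field_simps)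
  then show 1: "840 * (real (Suc (depth \<epsilon>)))\<^sup>2 \<le> \<epsilon>\<^sup>2 * 2 ^ depth \<epsilon>"
    unfolding depth_def by (rule LeastI)
  have "\<epsilon>\<^sup>2 < 1" using assms by (simp add: power_less_one_iff)
  with 1 show 2: "depth \<epsilon> \<ge> 1" by (cases "depth \<epsilon>") auto
  then obtain j where j: "depth \<epsilon> = Suc j" by (cases "depth \<epsilon>") auto
  \<comment> \<open>The accuracy condition fails one level earlier; doubling that inequality gives
    1680 = 2 * 840.\<close>
  then have "\<not> 840 * (real (Suc j))\<^sup>2 \<le> \<epsilon>\<^sup>2 * 2 ^ j"
    unfolding depth_def by (intro not_less_Least) simp
  then show "\<epsilon>\<^sup>2 * 2 ^ depth \<epsilon> \<le> 1680 * (real (depth \<epsilon>))\<^sup>2" by (simp add: j)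
qed

text \<open>In the upper bound for \<open>\<epsilon>\<^sup>2 * 2 ^ depth \<epsilon>\<close> the
  quadratic factor is absorbed by a quarter of the exponent; the rest is compared after taking
  logarithms.\<close>

lemma depth_le:
  assumes "0 < \<epsilon>" "\<epsilon> < 1"
  shows "real (depth \<epsilon>) \<le> 26 * (1 + ln (1 / \<epsilon>))"
proof -
  \<comment> \<open>With this scaling, \<open>x\<^sup>2\<close> costs a factor of order
    \<open>2 powr (2 * x)\<close> out of \<open>2 powr (8 * x)\<close>, and \<open>6 * x\<close>
    survives.\<close>
  define x where "x = real (depth \<epsilon>) / 8"
  have ln2: "1 / 2 \<le> ln (2::real)" using ln2_ge_two_thirds by simp
  have "1 + x * ln 2 \<le> 2 powr x"
    using exp_ge_add_one_self[of "x * ln 2"] by (simp add: powr_def)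
  moreover have "x / 2 \<le> x * ln 2"
    using mult_left_mono[OF ln2, of x] by (simp add: x_def)
  ultimately have "x \<le> 2 * 2 powr x" by simp
  then have "x\<^sup>2 \<le> (2 * 2 powr x)\<^sup>2"
    by (intro power_mono) (simp_all add: x_def)
  then have "x\<^sup>2 \<le> 4 * 2 powr (2 * x)"
    by (simp add: power_mult_distrib powr_power mult.commute)
  moreover have "\<epsilon>\<^sup>2 * 2 powr (8 * x) \<le> 107520 * x\<^sup>2"
    using depth(3)[OF assms] by (simp add: x_def power_divide powr_realpow)
  \<comment> \<open>Here 107520 = 1680 * 8^2, and 4 * 107520 is below 2^19.\<close>
  ultimately have "\<epsilon>\<^sup>2 * 2 powr (8 * x) \<le> 2 ^ 19 * 2 powr (2 * x)"
    using powr_ge_zero[of 2 "2 * x"] by (simp del: powr_ge_zero)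
  then have le: "ln (\<epsilon>\<^sup>2 * 2 powr (8 * x)) \<le> ln (2 ^ 19 * 2 powr (2 * x))"
    using assms by (subst ln_le_cancel_iff) auto
  have lhs: "ln (\<epsilon>\<^sup>2 * 2 powr (8 * x)) = 2 * ln \<epsilon> + 8 * x * ln 2"
    using assms by (simp add: ln_mult ln_realpow)
  have rhs: "ln (2 ^ 19 * 2 powr (2 * x)) = 19 * ln 2 + 2 * x * ln (2::real)"
    by (subst ln_mult) (simp_all only: ln_powr ln_realpow, simp_all)
  have "(6 * x - 19) * ln 2 \<le> 2 * ln (1 / \<epsilon>)"
    using le[unfolded lhs rhs] assms by (simp add: ln_div algebra_simps)
  moreover have "(6 * x - 19) * (1 / 2) \<le> (6 * x - 19) * ln 2" if "6 * x - 19 \<ge> 0"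
    using ln2 that by (rule mult_left_mono)
  moreover have "ln (1 / \<epsilon>) \<ge> 0" using assms by simp
  ultimately have "6 * x - 19 \<le> 4 * ln (1 / \<epsilon>)" by fastforce
  with \<open>ln (1 / \<epsilon>) \<ge> 0\<close> show ?thesis unfolding x_def by (simp add: algebra_simps)
qed

theorem theorem1p1:
  "\<exists>(A :: real \<Rightarrow> nat \<Rightarrow> real query_alg) (q :: real \<Rightarrow> nat).
     (\<lambda>\<epsilon>. real (q \<epsilon>)) \<in> soft_O (\<lambda>\<epsilon>. 1 / \<epsilon>\<^sup>2) \<and>
     (\<forall>\<epsilon>\<in>{0<..<1}. \<forall>N\<ge>1.
        within_queries N (q \<epsilon>) (A \<epsilon> N) \<and>
        (\<forall>D P. set_pmf D \<subseteq> {1..N} \<longrightarrow> pcond_oracle N D P \<longrightarrow>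
           measure_pmf.prob (run D P (A \<epsilon> N))
             {v. \<bar>v - tv_dist N D (pmf_of_set {1..N})\<bar> \<le> \<epsilon>} \<ge> 2 / 3))"
proof (intro exI conjI ballI allI impI)
  let ?q = "\<lambda>\<epsilon>. 7 * 2 ^ depth \<epsilon> * Suc (depth \<epsilon>) :: nat"
  \<comment> \<open>Two of the three logarithmic factors come from
    \<open>2 ^ depth \<epsilon>\<close>, the third from the number of levels; 23520 = 7 * 1680 *
    2.\<close>
  have "norm (real (?q \<epsilon>)) \<le> (23520 * 26 ^ 3) * norm (1 / \<epsilon>\<^sup>2 * (1 + ln (1 / \<epsilon>)) ^ 3)"
    if "\<epsilon> \<in> {0<..<1}" for \<epsilon> :: real
  proof -
    have \<epsilon>: "0 < \<epsilon>" "\<epsilon> < 1" using that by auto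
    have "real (?q \<epsilon>) \<le> 7 * 2 ^ depth \<epsilon> * (2 * real (depth \<epsilon>))"
      using depth(2)[OF \<epsilon>] by simp
    also have "\<dots> \<le> 7 * (1680 * (real (depth \<epsilon>))\<^sup>2 / \<epsilon>\<^sup>2) * (2 * real (depth \<epsilon>))"
      using depth(3)[OF \<epsilon>] \<epsilon> by (intro mult_right_mono mult_left_mono) (auto simp: field_simps)
    also have "\<dots> = 23520 / \<epsilon>\<^sup>2 * real (depth \<epsilon>) ^ 3"
      by (simp add: power2_eq_square power3_eq_cube)
    also have "\<dots> \<le> 23520 / \<epsilon>\<^sup>2 * (26 * (1 + ln (1 / \<epsilon>))) ^ 3"
      using depth_le[OF \<epsilon>] by (intro mult_left_mono power_mono) auto
    also have "\<dots> = (23520 * 26 ^ 3) * (1 / \<epsilon>\<^sup>2 * (1 + ln (1 / \<epsilon>)) ^ 3)"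
      unfolding power_mult_distrib by simp
    also have "\<dots> = (23520 * 26 ^ 3) * norm (1 / \<epsilon>\<^sup>2 * (1 + ln (1 / \<epsilon>)) ^ 3)"
      using \<epsilon> by (simp add: abs_mult)
    finally show ?thesis by simp
  qed
  then have "(\<lambda>\<epsilon>. real (?q \<epsilon>))
      \<in> O[principal {0<..<1}](\<lambda>\<epsilon>. 1 / \<epsilon>\<^sup>2 * (1 + ln (1 / \<epsilon>)) ^ 3)"
    by (intro bigoI[where c = "23520 * 26 ^ 3"]) (auto simp: eventually_principal)
  then show "(\<lambda>\<epsilon>. real (?q \<epsilon>)) \<in> soft_O (\<lambda>\<epsilon>. 1 / \<epsilon>\<^sup>2)"
    unfolding soft_O_def by (intro UN_I[of 3]) auto
next
  fix \<epsilon> :: real and N :: nat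
  assume "N \<ge> 1"
  then show "within_queries N (7 * 2 ^ depth \<epsilon> * Suc (depth \<epsilon>)) (tv_alg N (depth \<epsilon>))"
    by (rule within_queries_tv_alg)
next
  fix \<epsilon> :: real and N :: nat and D P
  assume "\<epsilon> \<in> {0<..<1}" "N \<ge> 1" "set_pmf D \<subseteq> {1..N}" "pcond_oracle N D P"
  then interpret pcond_access N D P by unfold_locales auto
  show "measure_pmf.prob (run D P (tv_alg N (depth \<epsilon>)))
      {v. \<bar>v - tv_dist N D (pmf_of_set {1..N})\<bar> \<le> \<epsilon>} \<ge> 2 / 3"
    using \<open>\<epsilon> \<in> {0<..<1}\<close> by (intro tv_alg_correct depth) auto
qed

end
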